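(* Let $K(\mathcal{M})$ be a Kripke model with classical domains such that there are $v, w \in K$ with $v < w$. If $a, b \in \mathcal{M}_v$ and $g : a \to b$ is a function contained in $\mathcal{M}_w$ but not in $\mathcal{M}_v$, then $K(\mathcal{M}) \not\Vdash \mathsf{Exp}$.
   Context: A Kripke frame $(K,\leq)$ is a set $K$ with a partial order $\leq$. A sound assignment for $K$ is a map $v \mapsto \mathcal{M}_v$ assigning to every node $v \in K$ a transitive model $\mathcal{M}_v$ of $\mathsf{ZF}$ such that, for $v \leq w$, $\mathcal{M}_v \subseteq \mathcal{M}_w$ and membership and equality statements true in $\mathcal{M}_v$ remain true in $\mathcal{M}_w$. The Kripke model with classical domains $K(\mathcal{M})$ has underlying frame $(K,\leq)$, domain $\mathcal{M}_v$ at node $v$, and membership relation at $v$ the restriction of $\in$ to $\mathcal{M}_v$. Forcing for formulas of the language of set theory with parameters in $\mathcal{M}_v$: $v \Vdash a \in b$ iff $a \in b$; $v \Vdash a = b$ iff $a = b$; $\wedge$ and $\vee$ are evaluated pointwise at $v$; $v \Vdash \varphi \rightarrow \psi$ iff for all $w \geq v$, $w \Vdash \varphi$ implies $w \Vdash \psi$; $v \Vdash \bot$ never; $v \Vdash \exists x\, \varphi(x)$ iff $v \Vdash \varphi(a)$ for some $a \in \mathcal{M}_v$; $v \Vdash \forall x\, \varphi(x)$ iff for all $w \geq v$ and all $a \in \mathcal{M}_w$, $w \Vdash \varphi(a)$. $K(\mathcal{M}) \Vdash \varphi$ means $v \Vdash \varphi$ for all $v \in K$. The axiom of exponentiation $\mathsf{Exp}$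 is $\forall x\, \forall y\, \exists z\, \forall f\, (f \in z \leftrightarrow f : x \to y)$, where $f : x \to y$ abbreviates the $\Delta_0$-formula stating that $f$ is a function from $x$ to $y$. *)

theory Defs
  imports Main
begin

text \<open>
  First-order formulas of the language of set theory, with variables named by natural numbers.
  Both the classical satisfaction relation and the forcing relation are defined on this syntax.
\<close>

datatype fm =
    Bot
  | Mem nat nat
  | Eq nat nat
  | And fm fm
  | Or fm fm
  | Imp fm fm
  | All nat fm
  | Ex nat fm

primrec fv :: "fm \<Rightarrow> nat set" where
  "fv Bot = {}"
| "fv (Mem i j) = {i, j}"
| "fv (Eq i j) = {i, j}"
| "fv (And \<phi> \<psi>) = fv \<phi> \<union> fv \<psi>"
| "fv (Or \<phi> \<psi>) = fv \<phi> \<union> fv \<psi>"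
| "fv (Imp \<phi> \<psi>) = fv \<phi> \<union> fv \<psi>"
| "fv (All i \<phi>) = fv \<phi> - {i}"
| "fv (Ex i \<phi>) = fv \<phi> - {i}"

definition Neg :: "fm \<Rightarrow> fm" where
  "Neg \<phi> = Imp \<phi> Bot"

definition Iff :: "fm \<Rightarrow> fm \<Rightarrow> fm" where
  "Iff \<phi> \<psi> = And (Imp \<phi> \<psi>) (Imp \<psi> \<phi>)"

definition BAll :: "nat \<Rightarrow> nat \<Rightarrow> fm \<Rightarrow> fm" where
  "BAll i j \<phi> = All i (Imp (Mem i j) \<phi>)"

definition BEx :: "nat \<Rightarrow> nat \<Rightarrow> fm \<Rightarrow> fm" where
  "BEx i j \<phi> = Ex i (And (Mem i j) \<phi>)"

text \<open>
  The ambient universe is a type \<open>'a\<close> with a membership relation \<open>E\<close> (\<open>E x y\<close> means that \<open>x\<close> is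
  an element of \<open>y\<close>). By Mostowski's theorem, well-foundedness and extensionality say
  precisely that \<open>('a, E)\<close> is, up to isomorphism, a transitive class of sets with the true membership
  relation. Nothing more is asked of the ambient universe, so it may in particular be the universe
  of all sets.
\<close>

definition set_universe :: "('a \<Rightarrow> 'a \<Rightarrow> bool) \<Rightarrow> bool" where
  "set_universe E \<longleftrightarrow> wfp E \<and> (\<forall>x y. (\<forall>z. E z x \<longleftrightarrow> E z y) \<longrightarrow> x = y)"

primrec sat :: "('a \<Rightarrow> 'a \<Rightarrow> bool) \<Rightarrow> 'a set \<Rightarrow> (nat \<Rightarrow> 'a) \<Rightarrow> fm \<Rightarrow> bool" where
  "sat E M e Bot \<longleftrightarrow> False"
| "sat E M e (Mem i j) \<longleftrightarrow> E (e i) (e j)"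
| "sat E M e (Eq i j) \<longleftrightarrow> e i = e j"
| "sat E M e (And \<phi> \<psi>) \<longleftrightarrow> sat E M e \<phi> \<and> sat E M e \<psi>"
| "sat E M e (Or \<phi> \<psi>) \<longleftrightarrow> sat E M e \<phi> \<or> sat E M e \<psi>"
| "sat E M e (Imp \<phi> \<psi>) \<longleftrightarrow> (sat E M e \<phi> \<longrightarrow> sat E M e \<psi>)"
| "sat E M e (All i \<phi>) \<longleftrightarrow> (\<forall>a\<in>M. sat E M (e(i := a)) \<phi>)"
| "sat E M e (Ex i \<phi>) \<longleftrightarrow> (\<exists>a\<in>M. sat E M (e(i := a)) \<phi>)"

definition Extensionality :: fm where
  "Extensionality = All 0 (All 1 (Imp (All 2 (Iff (Mem 2 0) (Mem 2 1))) (Eq 0 1)))"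

definition Foundation :: fm where
  "Foundation = All 0 (Imp (Ex 1 (Mem 1 0)) (Ex 1 (And (Mem 1 0) (All 2 (Imp (Mem 2 1) (Neg (Mem 2 0)))))))"

definition Pairing :: fm where
  "Pairing = All 0 (All 1 (Ex 2 (All 3 (Iff (Mem 3 2) (Or (Eq 3 0) (Eq 3 1))))))"

definition Union_ax :: fm where
  "Union_ax = All 0 (Ex 1 (All 2 (Iff (Mem 2 1) (Ex 3 (And (Mem 2 3) (Mem 3 0))))))"

definition Power_set :: fm where
  "Power_set = All 0 (Ex 1 (All 2 (Iff (Mem 2 1) (All 3 (Imp (Mem 3 2) (Mem 3 0))))))"

definition Infinity :: fm where
  "Infinity = Ex 0 (And
     (Ex 1 (And (Mem 1 0) (All 2 (Neg (Mem 2 1)))))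
     (All 1 (Imp (Mem 1 0)
        (Ex 2 (And (Mem 2 0) (All 3 (Iff (Mem 3 2) (Or (Mem 3 1) (Eq 3 1)))))))))"

text \<open>
  In the two schemes, the variables of \<open>\<phi>\<close> other than the displayed ones are parameters; the
  universal closure over them is taken in \<open>models_ZF\<close>.
\<close>

definition Separation_instances :: "fm set" where
  "Separation_instances =
     {All x (Ex y (All z (Iff (Mem z y) (And (Mem z x) \<phi>)))) | x y z \<phi>.
        distinct [x, y, z] \<and> y \<notin> fv \<phi>}"

definition Replacement_instances :: "fm set" where
  "Replacement_instances =
     {All a (Imp (BAll x a (Ex u (All y (Iff \<phi> (Eq y u)))))
                 (Ex b (All y (Iff (Mem y b) (BEx x a \<phi>))))) | a b x y u \<phi>.
        distinct [a, b, x, y, u] \<and> u \<notin> fv \<phi> \<and> b \<notin> fv \<phi>}"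

definition ZF :: "fm set" where
  "ZF = {Extensionality, Foundation, Pairing, Union_ax, Power_set, Infinity}
        \<union> Separation_instances \<union> Replacement_instances"

definition models_ZF :: "('a \<Rightarrow> 'a \<Rightarrow> bool) \<Rightarrow> 'a set \<Rightarrow> bool" where
  "models_ZF E M \<longleftrightarrow> M \<noteq> {} \<and> (\<forall>\<phi>\<in>ZF. \<forall>e. range e \<subseteq> M \<longrightarrow> sat E M e \<phi>)"

definition transitive_model_ZF :: "('a \<Rightarrow> 'a \<Rightarrow> bool) \<Rightarrow> 'a set \<Rightarrow> bool" where
  "transitive_model_ZF E M \<longleftrightarrow> (\<forall>x\<in>M. \<forall>y. E y x \<longrightarrow> y \<in> M) \<and> models_ZF E M"

text \<open>
  The last clause of the following definition is the preservation of atomic truths. It is automatic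
  here, since all models carry the ambient membership relation.
\<close>

definition sound_assignment ::
    "'k set \<Rightarrow> 'k rel \<Rightarrow> ('a \<Rightarrow> 'a \<Rightarrow> bool) \<Rightarrow> ('k \<Rightarrow> 'a set) \<Rightarrow> bool" where
  "sound_assignment K le E \<M> \<longleftrightarrow>
     (\<forall>v\<in>K. transitive_model_ZF E (\<M> v)) \<and>
     (\<forall>v\<in>K. \<forall>w\<in>K. (v, w) \<in> le \<longrightarrow>
        \<M> v \<subseteq> \<M> w \<and>
        (\<forall>e i j. range e \<subseteq> \<M> v \<longrightarrow>
           (sat E (\<M> v) e (Mem i j) \<longrightarrow> sat E (\<M> w) e (Mem i j)) \<and>
           (sat E (\<M> v) e (Eq i j) \<longrightarrow> sat E (\<M> w) e (Eq i j))))"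

definition kripke_model_classical_domains ::
    "'k set \<Rightarrow> 'k rel \<Rightarrow> ('a \<Rightarrow> 'a \<Rightarrow> bool) \<Rightarrow> ('k \<Rightarrow> 'a set) \<Rightarrow> bool" where
  "kripke_model_classical_domains K le E \<M> \<longleftrightarrow>
     set_universe E \<and> partial_order_on K le \<and> sound_assignment K le E \<M>"

primrec forces ::
    "'k set \<Rightarrow> 'k rel \<Rightarrow> ('a \<Rightarrow> 'a \<Rightarrow> bool) \<Rightarrow> ('k \<Rightarrow> 'a set) \<Rightarrow> 'k \<Rightarrow> (nat \<Rightarrow> 'a) \<Rightarrow> fm \<Rightarrow> bool" where
  "forces K le E \<M> v e Bot \<longleftrightarrow> False"
| "forces K le E \<M> v e (Mem i j) \<longleftrightarrow> E (e i) (e j)"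
| "forces K le E \<M> v e (Eq i j) \<longleftrightarrow> e i = e j"
| "forces K le E \<M> v e (And \<phi> \<psi>) \<longleftrightarrow> forces K le E \<M> v e \<phi> \<and> forces K le E \<M> v e \<psi>"
| "forces K le E \<M> v e (Or \<phi> \<psi>) \<longleftrightarrow> forces K le E \<M> v e \<phi> \<or> forces K le E \<M> v e \<psi>"
| "forces K le E \<M> v e (Imp \<phi> \<psi>) \<longleftrightarrow>
     (\<forall>w\<in>K. (v, w) \<in> le \<longrightarrow> forces K le E \<M> w e \<phi> \<longrightarrow> forces K le E \<M> w e \<psi>)"
| "forces K le E \<M> v e (All i \<phi>) \<longleftrightarrow>
     (\<forall>w\<in>K. (v, w) \<in> le \<longrightarrow> (\<forall>a\<in>\<M> w. forces K le E \<M> w (e(i := a)) \<phi>))"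
| "forces K le E \<M> v e (Ex i \<phi>) \<longleftrightarrow> (\<exists>a\<in>\<M> v. forces K le E \<M> v (e(i := a)) \<phi>)"

text \<open>
  For a sentence, the assignment \<open>e\<close> below is irrelevant; it only ranges over parameters in the
  domain at the node.
\<close>

definition kripke_forces ::
    "'k set \<Rightarrow> 'k rel \<Rightarrow> ('a \<Rightarrow> 'a \<Rightarrow> bool) \<Rightarrow> ('k \<Rightarrow> 'a set) \<Rightarrow> fm \<Rightarrow> bool" where
  "kripke_forces K le E \<M> \<phi> \<longleftrightarrow> (\<forall>v\<in>K. \<forall>e. range e \<subseteq> \<M> v \<longrightarrow> forces K le E \<M> v e \<phi>)"

text \<open>
  The formulas for \<open>d = {s, t}\<close>, for the Kuratowski pair \<open>p = (s, t)\<close>, and for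
  \<open>f : x \<rightarrow> y\<close>. All quantifiers are bounded; the bound variables are chosen larger than all the
  arguments to avoid capture.
\<close>

definition upair_fm :: "nat \<Rightarrow> nat \<Rightarrow> nat \<Rightarrow> fm" where
  "upair_fm d s t =
     (let z = Suc (Max {d, s, t})
      in And (Mem s d) (And (Mem t d) (BAll z d (Or (Eq z s) (Eq z t)))))"

definition opair_fm :: "nat \<Rightarrow> nat \<Rightarrow> nat \<Rightarrow> fm" where
  "opair_fm p s t =
     (let c = Suc (Max {p, s, t}); d = Suc c
      in BEx c p (BEx d p (And (upair_fm c s s) (And (upair_fm d s t) (upair_fm p c d)))))"

definition function_fm :: "nat \<Rightarrow> nat \<Rightarrow> nat \<Rightarrow> fm" where
  "function_fm f x y =
     (let p = Suc (Max {f, x, y}); s = Suc p; t = Suc s; u = Suc t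
      in And (BAll p f (BEx s x (BEx t y (opair_fm p s t))))
             (BAll s x (BEx t y (And
                (BEx p f (opair_fm p s t))
                (BAll u y (Imp (BEx p f (opair_fm p s u)) (Eq u t)))))))"

definition Exp :: fm where
  "Exp = All 0 (All 1 (Ex 2 (All 3 (Iff (Mem 3 2) (function_fm 3 0 1)))))"

definition is_upair :: "('a \<Rightarrow> 'a \<Rightarrow> bool) \<Rightarrow> 'a \<Rightarrow> 'a \<Rightarrow> 'a \<Rightarrow> bool" where
  "is_upair E d s t \<longleftrightarrow> (\<forall>z. E z d \<longleftrightarrow> z = s \<or> z = t)"

definition is_opair :: "('a \<Rightarrow> 'a \<Rightarrow> bool) \<Rightarrow> 'a \<Rightarrow> 'a \<Rightarrow> 'a \<Rightarrow> bool" where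
  "is_opair E p s t \<longleftrightarrow> (\<exists>c d. is_upair E c s s \<and> is_upair E d s t \<and> is_upair E p c d)"

definition is_function :: "('a \<Rightarrow> 'a \<Rightarrow> bool) \<Rightarrow> 'a \<Rightarrow> 'a \<Rightarrow> 'a \<Rightarrow> bool" where
  "is_function E f a b \<longleftrightarrow>
     (\<forall>p. E p f \<longrightarrow> (\<exists>s t. E s a \<and> E t b \<and> is_opair E p s t)) \<and>
     (\<forall>s. E s a \<longrightarrow> (\<exists>!t. E t b \<and> (\<exists>p. E p f \<and> is_opair E p s t)))"

end

theory Submission
  imports Defs
begin

text \<open>
  If the exponential \<open>z\<close> of \<open>a\<close> and \<open>b\<close> exists at \<open>v\<close>, then at the later node \<open>w\<close> it must contain \<open>g\<close>,
  because the \<open>\<Delta>\<^sub>0\<close>-formula saying that \<open>g\<close> is a function is absolute between forcing and truth in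
  the ambient universe. But \<open>z \<in> \<M> v\<close> and \<open>\<M> v\<close> is transitive, so \<open>g \<in> \<M> v\<close>.
\<close>

text \<open>The order and domain facts behind absoluteness: transitive domains let a bounded
  quantifier range over all ambient elements of its bound, and growing domains keep parameters
  available at later nodes.\<close>

locale transitive_domains =
  fixes K :: "'k set" and le :: "'k rel"
    and E :: "'a \<Rightarrow> 'a \<Rightarrow> bool" and \<M> :: "'k \<Rightarrow> 'a set"
  assumes le_refl: "v \<in> K \<Longrightarrow> (v, v) \<in> le"
    and le_trans: "(u, v) \<in> le \<Longrightarrow> (v, w) \<in> le \<Longrightarrow> (u, w) \<in> le"
    and domain_trans: "v \<in> K \<Longrightarrow> x \<in> \<M> v \<Longrightarrow> E y x \<Longrightarrow> y \<in> \<M> v"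
    and domain_mono: "v \<in> K \<Longrightarrow> w \<in> K \<Longrightarrow> (v, w) \<in> le \<Longrightarrow> x \<in> \<M> v \<Longrightarrow> x \<in> \<M> w"
begin

text \<open>\<open>P\<close> and \<open>Q\<close> do not depend on the node, so the quantification
  over later nodes collapses; reflexivity supplies \<open>v\<close> itself.\<close>

lemma forces_Imp_absolute:
  assumes "v \<in> K"
    and "\<And>w. w \<in> K \<Longrightarrow> (v, w) \<in> le \<Longrightarrow> forces K le E \<M> w e \<phi> \<longleftrightarrow> P"
    and "\<And>w. w \<in> K \<Longrightarrow> (v, w) \<in> le \<Longrightarrow> forces K le E \<M> w e \<psi> \<longleftrightarrow> Q"
  shows "forces K le E \<M> v e (Imp \<phi> \<psi>) \<longleftrightarrow> (P \<longrightarrow> Q)"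
  using assms le_refl by auto

text \<open>A set in \<open>\<M> v\<close> gains no elements at later nodes, because membership is
  ambient and \<open>\<M> v\<close> is transitive. \<open>P\<close> must still hold at every later
  node, since both \<open>All\<close> and \<open>Imp\<close> move upwards; \<open>le_trans\<close>
  composes the two moves.\<close>

lemma forces_BAll_absolute:
  assumes "v \<in> K" "i \<noteq> j" "e j \<in> \<M> v"
    and P: "\<And>w a. w \<in> K \<Longrightarrow> (v, w) \<in> le \<Longrightarrow> E a (e j) \<Longrightarrow>
      forces K le E \<M> w (e(i := a)) \<phi> \<longleftrightarrow> P a"
  shows "forces K le E \<M> v e (BAll i j \<phi>) \<longleftrightarrow> (\<forall>a. E a (e j) \<longrightarrow> P a)"
proof
  assume forced: "forces K le E \<M> v e (BAll i j \<phi>)"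
  show "\<forall>a. E a (e j) \<longrightarrow> P a"
  proof (intro allI impI)
    fix a assume a: "E a (e j)"
    then have "a \<in> \<M> v" using assms domain_trans by blast
    then have "forces K le E \<M> v (e(i := a)) \<phi>"
      using forced a \<open>v \<in> K\<close> \<open>i \<noteq> j\<close> le_refl by (auto simp: BAll_def)
    then show "P a" using P[of v a] a \<open>v \<in> K\<close> le_refl by blast
  qed
next
  assume "\<forall>a. E a (e j) \<longrightarrow> P a"
  then show "forces K le E \<M> v e (BAll i j \<phi>)"
    using P \<open>i \<noteq> j\<close> le_trans by (auto simp: BAll_def)
qed

text \<open>A witness is chosen at the node itself, so, in contrast to \<open>BAll\<close>,
  agreement with \<open>P\<close> is required at \<open>v\<close> alone.\<close>

lemma forces_BEx_absolute:
  assumes "v \<in> K" "i \<noteq> j" "e j \<in> \<M> v"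
    and "\<And>a. E a (e j) \<Longrightarrow> forces K le E \<M> v (e(i := a)) \<phi> \<longleftrightarrow> P a"
  shows "forces K le E \<M> v e (BEx i j \<phi>) \<longleftrightarrow> (\<exists>a. E a (e j) \<and> P a)"
  using assms domain_trans by (auto simp: BEx_def)

text \<open>Only the value of \<open>d\<close> has to lie in the domain, because \<open>d\<close>
  alone bounds a quantifier.\<close>

lemma forces_upair_fm:
  assumes "v \<in> K" "e d \<in> \<M> v"
  shows "forces K le E \<M> v e (upair_fm d s t) \<longleftrightarrow> is_upair E (e d) (e s) (e t)"
proof -
  define z where "z = Suc (Max {d, s, t})"
  have fresh: "z \<noteq> d" "z \<noteq> s" "z \<noteq> t"
    unfolding z_def by auto
  have "forces K le E \<M> v e (BAll z d (Or (Eq z s) (Eq z t))) \<longleftrightarrow>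
      (\<forall>a. E a (e d) \<longrightarrow> a = e s \<or> a = e t)"
    by (rule forces_BAll_absolute) (use assms fresh in auto)
  moreover have "upair_fm d s t = And (Mem s d) (And (Mem t d) (BAll z d (Or (Eq z s) (Eq z t))))"
    by (simp add: upair_fm_def z_def Let_def)
  ultimately show ?thesis
    by (auto simp: is_upair_def)
qed

lemma forces_opair_fm:
  assumes "v \<in> K" "e p \<in> \<M> v"
  shows "forces K le E \<M> v e (opair_fm p s t) \<longleftrightarrow> is_opair E (e p) (e s) (e t)"
proof -
  define c where "c = Suc (Max {p, s, t})"
  define d where "d = Suc c"
  have fresh: "c \<noteq> p" "c \<noteq> s" "c \<noteq> t" "d \<noteq> p" "d \<noteq> s" "d \<noteq> t" "c \<noteq> d"
    unfolding d_def c_def by auto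
  have "forces K le E \<M> v e
      (BEx c p (BEx d p (And (upair_fm c s s) (And (upair_fm d s t) (upair_fm p c d))))) \<longleftrightarrow>
    (\<exists>x. E x (e p) \<and> (\<exists>y. E y (e p) \<and>
      is_upair E x (e s) (e s) \<and> is_upair E y (e s) (e t) \<and> is_upair E (e p) x y))"
  proof (rule forces_BEx_absolute)
    fix x assume x: "E x (e p)"
    \<comment> \<open>The bound is left as \<open>(e(c := x)) p\<close> so that the rule unifies;
      freshness of \<open>c\<close> reduces it to \<open>e p\<close> afterwards. The same pattern
      recurs below.\<close>
    have "forces K le E \<M> v (e(c := x))
        (BEx d p (And (upair_fm c s s) (And (upair_fm d s t) (upair_fm p c d)))) \<longleftrightarrow>
      (\<exists>y. E y ((e(c := x)) p) \<and>
        is_upair E x (e s) (e s) \<and> is_upair E y (e s) (e t) \<and> is_upair E (e p) x y)"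
      by (rule forces_BEx_absolute)
        (use assms fresh x domain_trans[OF assms] in \<open>auto simp: forces_upair_fm\<close>)
    then show "forces K le E \<M> v (e(c := x))
        (BEx d p (And (upair_fm c s s) (And (upair_fm d s t) (upair_fm p c d)))) \<longleftrightarrow>
      (\<exists>y. E y (e p) \<and>
        is_upair E x (e s) (e s) \<and> is_upair E y (e s) (e t) \<and> is_upair E (e p) x y)"
      using fresh by simp
  qed (use assms fresh in auto)
  \<comment> \<open>The components range over the whole universe in \<open>is_opair\<close>, but
    \<open>is_upair E (e p) x y\<close> already makes them elements of \<open>e p\<close>.\<close>
  also have "\<dots> \<longleftrightarrow> is_opair E (e p) (e s) (e t)"
    unfolding is_opair_def using is_upair_def[of E "e p"] by blast
  finally show ?thesis
    by (simp add: opair_fm_def c_def d_def Let_def)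
qed

lemma forces_ex_opair_fm:
  assumes "v \<in> K" "e f \<in> \<M> v" "p \<noteq> f" "p \<noteq> s" "p \<noteq> t"
  shows "forces K le E \<M> v e (BEx p f (opair_fm p s t)) \<longleftrightarrow>
    (\<exists>q. E q (e f) \<and> is_opair E q (e s) (e t))"
  by (rule forces_BEx_absolute)
    (use assms domain_trans in \<open>auto simp: forces_opair_fm\<close>)

text \<open>Every quantifier, including those inside \<open>opair_fm\<close>, is bounded by a
  parameter or by an element of one, so the absoluteness rules apply from the inside out.\<close>

lemma forces_function_fm:
  assumes v: "v \<in> K" and dom: "e f \<in> \<M> v" "e x \<in> \<M> v" "e y \<in> \<M> v"
  shows "forces K le E \<M> v e (function_fm f x y) \<longleftrightarrow> is_function E (e f) (e x) (e y)"
proof -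
  define p where "p = Suc (Max {f, x, y})"
  define s where "s = Suc p"
  define t where "t = Suc s"
  define u where "u = Suc t"
  have fresh: "p \<noteq> f" "p \<noteq> x" "p \<noteq> y" "s \<noteq> f" "s \<noteq> x" "s \<noteq> y" "t \<noteq> f" "t \<noteq> x" "t \<noteq> y"
    "u \<noteq> f" "u \<noteq> x" "u \<noteq> y" "p \<noteq> s" "p \<noteq> t" "p \<noteq> u" "s \<noteq> t" "s \<noteq> u" "t \<noteq> u"
    unfolding u_def t_def s_def p_def by auto
  note fresh = fresh fresh[symmetric]
  \<comment> \<open>The rule for \<open>BAll\<close> evaluates its body at later nodes, where the
    parameters and the elements of \<open>e f\<close> must again lie in the domain.\<close>
  have dom': "e f \<in> \<M> w" "e x \<in> \<M> w" "e y \<in> \<M> w" if "w \<in> K" "(v, w) \<in> le" for w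
    using domain_mono[OF v that] dom by simp_all
  have elem: "a \<in> \<M> w" if "E a (e f)" "w \<in> K" "(v, w) \<in> le" for a w
    using domain_trans[OF that(2)] dom'(1)[OF that(2,3)] that(1) by blast
  have relation: "forces K le E \<M> v e (BAll p f (BEx s x (BEx t y (opair_fm p s t)))) \<longleftrightarrow>
    (\<forall>q. E q (e f) \<longrightarrow> (\<exists>i. E i (e x) \<and> (\<exists>j. E j (e y) \<and> is_opair E q i j)))"
  proof (rule forces_BAll_absolute)
    fix w q assume w: "w \<in> K" "(v, w) \<in> le" and q: "E q (e f)"
    have "forces K le E \<M> w (e(p := q, s := i)) (BEx t y (opair_fm p s t)) \<longleftrightarrow>
      (\<exists>j. E j ((e(p := q, s := i)) y) \<and> is_opair E q i j)" for i
      by (rule forces_BEx_absolute)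
        (use w dom'[OF w] elem[OF q w] fresh in \<open>simp_all add: forces_opair_fm\<close>)
    then have "forces K le E \<M> w (e(p := q)) (BEx s x (BEx t y (opair_fm p s t))) \<longleftrightarrow>
      (\<exists>i. E i ((e(p := q)) x) \<and> (\<exists>j. E j (e y) \<and> is_opair E q i j))"
      by (intro forces_BEx_absolute) (use w dom'[OF w] fresh in simp_all)
    then show "forces K le E \<M> w (e(p := q)) (BEx s x (BEx t y (opair_fm p s t))) \<longleftrightarrow>
      (\<exists>i. E i (e x) \<and> (\<exists>j. E j (e y) \<and> is_opair E q i j))"
      using fresh by simp
  qed (use v dom fresh in auto)
  \<comment> \<open>The graph of \<open>e f\<close>, read in the ambient universe and hence
    independent of the node, as \<open>forces_Imp_absolute\<close> demands.\<close>
  define G where "G i j \<longleftrightarrow> (\<exists>q. E q (e f) \<and> is_opair E q i j)" for i j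
  have unique: "forces K le E \<M> w (e(s := i, t := j))
      (BAll u y (Imp (BEx p f (opair_fm p s u)) (Eq u t))) \<longleftrightarrow>
    (\<forall>k. E k ((e(s := i, t := j)) y) \<longrightarrow> G i k \<longrightarrow> k = j)"
    if w: "w \<in> K" "(v, w) \<in> le" for w i j
  proof (rule forces_BAll_absolute)
    fix w' k assume w': "w' \<in> K" "(w, w') \<in> le"
    show "forces K le E \<M> w' (e(s := i, t := j, u := k))
        (Imp (BEx p f (opair_fm p s u)) (Eq u t)) \<longleftrightarrow> (G i k \<longrightarrow> k = j)"
    proof (rule forces_Imp_absolute)
      fix w'' assume w'': "w'' \<in> K" "(w', w'') \<in> le"
      \<comment> \<open>Three moves upwards: the outer \<open>BAll\<close> leads to
        \<open>w\<close>, the inner one to \<open>w'\<close>, and the implication to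
        \<open>w''\<close>.\<close>
      have le: "(v, w'') \<in> le" by (rule le_trans[OF w(2) le_trans[OF w'(2) w''(2)]])
      show "forces K le E \<M> w'' (e(s := i, t := j, u := k)) (BEx p f (opair_fm p s u)) \<longleftrightarrow>
          G i k"
        using w''(1) dom'[OF w''(1) le] fresh by (simp add: forces_ex_opair_fm G_def)
    qed (use w' fresh in auto)
  qed (use w dom'[OF w] fresh in simp_all)
  have total: "forces K le E \<M> v e (BAll s x (BEx t y (And
        (BEx p f (opair_fm p s t))
        (BAll u y (Imp (BEx p f (opair_fm p s u)) (Eq u t)))))) \<longleftrightarrow>
    (\<forall>i. E i (e x) \<longrightarrow> (\<exists>j. E j (e y) \<and> G i j \<and> (\<forall>k. E k (e y) \<longrightarrow> G i k \<longrightarrow> k = j)))"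
  proof (rule forces_BAll_absolute)
    fix w i assume w: "w \<in> K" "(v, w) \<in> le"
    have "forces K le E \<M> w (e(s := i)) (BEx t y (And
        (BEx p f (opair_fm p s t))
        (BAll u y (Imp (BEx p f (opair_fm p s u)) (Eq u t))))) \<longleftrightarrow>
      (\<exists>j. E j ((e(s := i)) y) \<and> G i j \<and> (\<forall>k. E k (e y) \<longrightarrow> G i k \<longrightarrow> k = j))"
      by (rule forces_BEx_absolute)
        (use w dom'[OF w] fresh in \<open>simp_all add: forces_ex_opair_fm unique G_def\<close>)
    then show "forces K le E \<M> w (e(s := i)) (BEx t y (And
        (BEx p f (opair_fm p s t))
        (BAll u y (Imp (BEx p f (opair_fm p s u)) (Eq u t))))) \<longleftrightarrow>
      (\<exists>j. E j (e y) \<and> G i j \<and> (\<forall>k. E k (e y) \<longrightarrow> G i k \<longrightarrow> k = j))"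
      using fresh by simp
  qed (use v dom fresh in auto)
  have "function_fm f x y = And (BAll p f (BEx s x (BEx t y (opair_fm p s t))))
      (BAll s x (BEx t y (And
        (BEx p f (opair_fm p s t))
        (BAll u y (Imp (BEx p f (opair_fm p s u)) (Eq u t))))))"
    by (simp add: function_fm_def p_def s_def t_def u_def Let_def)
  then have "forces K le E \<M> v e (function_fm f x y) \<longleftrightarrow>
    (\<forall>q. E q (e f) \<longrightarrow> (\<exists>i. E i (e x) \<and> (\<exists>j. E j (e y) \<and> is_opair E q i j))) \<and>
    (\<forall>i. E i (e x) \<longrightarrow> (\<exists>j. E j (e y) \<and> G i j \<and> (\<forall>k. E k (e y) \<longrightarrow> G i k \<longrightarrow> k = j)))"
    using relation total by simp
  \<comment> \<open>Unfolding \<open>Ex1_def\<close> splits unique existence into a value and its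
    uniqueness, the two conjuncts under \<open>BEx t y\<close>.\<close>
  also have "\<dots> \<longleftrightarrow> is_function E (e f) (e x) (e y)"
    unfolding is_function_def G_def Ex1_def by (simp add: imp_conjL conj_assoc)
  finally show ?thesis .
qed

lemma function_in_exponential:
  assumes exp: "forces K le E \<M> v e Exp"
    and vw: "v \<in> K" "w \<in> K" "(v, w) \<in> le"
    and ab: "a \<in> \<M> v" "b \<in> \<M> v"
    and g: "is_function E g a b" "g \<in> \<M> w"
  shows "g \<in> \<M> v"
proof -
  have "forces K le E \<M> v (e(0 := a, 1 := b)) (Ex 2 (All 3 (Iff (Mem 3 2) (function_fm 3 0 1))))"
    using exp vw(1) ab le_refl unfolding Exp_def by simp
  \<comment> \<open>The existential is evaluated at \<open>v\<close>, so \<open>z\<close> is fixed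
    there, before the universal quantifier over functions moves on to \<open>w\<close>.\<close>
  then obtain z where z: "z \<in> \<M> v" and forced:
    "forces K le E \<M> v (e(0 := a, 1 := b, 2 := z)) (All 3 (Iff (Mem 3 2) (function_fm 3 0 1)))"
    by auto
  let ?e = "e(0 := a, 1 := b, 2 := z, 3 := g)"
  \<comment> \<open>The universal quantifier is instantiated at \<open>w\<close> with
    \<open>g\<close>; of the equivalence only the direction from functions to members of
    \<open>z\<close> is kept.\<close>
  have "forces K le E \<M> w ?e (Imp (function_fm 3 0 1) (Mem 3 2))"
    using forced vw g(2) by (simp add: Iff_def)
  moreover have "forces K le E \<M> w ?e (function_fm 3 0 1)"
    using forces_function_fm[of w ?e 3 0 1] vw ab g domain_mono by simp
  ultimately have "E g z"
    using vw(2) le_refl by simp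
  then show ?thesis
    using z vw(1) domain_trans by blast
qed

end

lemma kripke_model_transitive_domains:
  assumes "kripke_model_classical_domains K le E \<M>"
  shows "transitive_domains K le E \<M>"
proof -
  have po: "partial_order_on K le" and sa: "sound_assignment K le E \<M>"
    using assms by (auto simp: kripke_model_classical_domains_def)
  show ?thesis
  proof
    show "(v, v) \<in> le" if "v \<in> K" for v
      using po that by (auto simp: partial_order_on_def preorder_on_def refl_on_def)
    show "(u, w) \<in> le" if "(u, v) \<in> le" "(v, w) \<in> le" for u v w
      using po that unfolding partial_order_on_def preorder_on_def by (blast dest: transD)
    show "y \<in> \<M> v" if "v \<in> K" "x \<in> \<M> v" "E y x" for v x y
      using sa that unfolding sound_assignment_def transitive_model_ZF_def by blast
    show "x \<in> \<M> w" if "v \<in> K" "w \<in> K" "(v, w) \<in> le" "x \<in> \<M> v" for v w x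
      using sa that unfolding sound_assignment_def by blast
  qed
qed

theorem proposition23:
  fixes K :: "'k set" and le :: "'k rel"
    and E :: "'a \<Rightarrow> 'a \<Rightarrow> bool" and \<M> :: "'k \<Rightarrow> 'a set"
    and v w :: 'k and a b g :: 'a
  assumes "kripke_model_classical_domains K le E \<M>"
    and "v \<in> K" and "w \<in> K" and "(v, w) \<in> le" and "v \<noteq> w"
    and "a \<in> \<M> v" and "b \<in> \<M> v"
    and "is_function E g a b" and "g \<in> \<M> w" and "g \<notin> \<M> v"
  shows "\<not> kripke_forces K le E \<M> Exp"
proof
  interpret transitive_domains K le E \<M>
    using assms(1) by (rule kripke_model_transitive_domains)
  assume "kripke_forces K le E \<M> Exp"
  \<comment> \<open>The constant assignment serves as one with range inside \<open>\<M> v\<close>;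
    the quantifiers of \<open>Exp\<close> overwrite the relevant values.\<close>
  then have "forces K le E \<M> v (\<lambda>_. a) Exp"
    using \<open>v \<in> K\<close> \<open>a \<in> \<M> v\<close> by (auto simp: kripke_forces_def)
  then show False
    using function_in_exponential assms by blast
qed

end
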